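(* Let $(G,+,\preceq)$ be a partially ordered abelian group, $\mathbb{K}$ a field of characteristic zero, and let $A=\bigoplus_{g\in G}A_g$ be an Artinian $G$-graded $\mathbb{K}$-algebra. Then $A$ is Cox-Gorenstein if and only if $A$ has the Poincaré duality.
   Context: Algebras are commutative, of the form $A=\mathbb{K}[X_1,\dots,X_n]/I$ with $\mathbb{K}[X_1,\dots,X_n]$ $G$-graded (variables homogeneous) and $I$ a $G$-homogeneous ideal. Graded algebras are always assumed to have degree-$0$ piece equal to $\mathbb{K}$. $A$ is Artinian if it is an Artinian ring when the grading is forgotten. Let $\mathfrak m=(\overline{X_1},\dots,\overline{X_n})\subset A$. The Artinian algebra $A$ is Cox-Gorenstein if there is $\omega\in G$ such that $\operatorname{soc}(A):=(0:\mathfrak m)=A_\omega\simeq\mathbb{K}$; $\omega$ is called the socle degree. $A$ has a greatest element $A_\omega$ if $A_\omega\ne 0$ and $g\preceq\omega$ for all $g$ with $A_g\neq0$. An Artinian $G$-graded algebra $A$ having a greatest element $A_\omega$ has the Poincaré duality if $A_\omega\simeq\mathbb{K}$, the multiplication maps $A_g\times A_{\omega-g}\to A_\omega$ are perfect pairings whenever $A_g$ and $A_{\omega-g}$ are non-zero, and moreover, if one of $A_g,A_{\omega-g}$ is zero then the other is also zero.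
   Formalization: The formal theorem adds that the grading is positive (A_g ≠ 0 implies 0 ⪯ g); without it the claim fails, e.g. for K[X]/(X²), deg X = 1, with Z in the reversed order. Poincaré duality itself implies this condition. *)

theory Defs
  imports
    "HOL-Library.Poly_Mapping"
    "HOL-Library.FuncSet"
    "HOL-Algebra.QuotRing"
    "HOL-Algebra.Algebraic_Closure_Type"
begin

section \<open>Graded polynomial rings\<close>

text \<open>Polynomials over \<open>'k\<close> in variables indexed by the type \<open>'x\<close>: finitely supported functions
  on exponent vectors, multiplied by convolution.\<close>

type_synonym ('x, 'k) mpoly = "('x \<Rightarrow>\<^sub>0 nat) \<Rightarrow>\<^sub>0 'k"

abbreviation mpoly_ring :: "('x, 'k::comm_ring_1) mpoly ring" where
  "mpoly_ring \<equiv> ring_of_type_algebra"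

definition mvar :: "'x \<Rightarrow> ('x, 'k::comm_ring_1) mpoly" where
  "mvar i = Poly_Mapping.single (Poly_Mapping.single i 1) 1"

definition mconst :: "'k \<Rightarrow> ('x, 'k::comm_ring_1) mpoly" where
  "mconst c = Poly_Mapping.single 0 c"

text \<open>A grading in which the variables are homogeneous is given by the degrees \<open>d i\<close> of the
  variables.  The inner sum is the multiple \<open>lookup m i \<cdot> d i\<close> in the group.\<close>

definition mdeg :: "('x \<Rightarrow> 'g::ab_group_add) \<Rightarrow> ('x \<Rightarrow>\<^sub>0 nat) \<Rightarrow> 'g" where
  "mdeg d m = (\<Sum>i\<in>Poly_Mapping.keys m. \<Sum>j<Poly_Mapping.lookup m i. d i)"

definition mpoly_piece :: "('x \<Rightarrow> 'g::ab_group_add) \<Rightarrow> 'g \<Rightarrow> ('x, 'k::comm_ring_1) mpoly set" where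
  "mpoly_piece d g = {f. \<forall>m\<in>Poly_Mapping.keys f. mdeg d m = g}"

definition mpoly_component ::
  "('x \<Rightarrow> 'g::ab_group_add) \<Rightarrow> 'g \<Rightarrow> ('x, 'k::comm_ring_1) mpoly \<Rightarrow> ('x, 'k) mpoly" where
  "mpoly_component d g f =
     (\<Sum>m\<in>{m \<in> Poly_Mapping.keys f. mdeg d m = g}. Poly_Mapping.single m (Poly_Mapping.lookup f m))"

definition homogeneous_ideal ::
  "('x \<Rightarrow> 'g::ab_group_add) \<Rightarrow> ('x, 'k::comm_ring_1) mpoly set \<Rightarrow> bool" where
  "homogeneous_ideal d I \<longleftrightarrow>
     ideal I mpoly_ring \<and> (\<forall>f\<in>I. \<forall>g. mpoly_component d g f \<in> I)"

section \<open>Graded quotient algebras\<close>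

abbreviation quot_alg :: "('x, 'k::comm_ring_1) mpoly set \<Rightarrow> ('x, 'k) mpoly set ring" where
  "quot_alg I \<equiv> mpoly_ring Quot I"

definition cls :: "('x, 'k::comm_ring_1) mpoly set \<Rightarrow> ('x, 'k) mpoly \<Rightarrow> ('x, 'k) mpoly set" where
  "cls I f = I +>\<^bsub>mpoly_ring\<^esub> f"

definition alg_piece ::
  "('x \<Rightarrow> 'g::ab_group_add) \<Rightarrow> ('x, 'k::comm_ring_1) mpoly set \<Rightarrow> 'g \<Rightarrow> ('x, 'k) mpoly set set" where
  "alg_piece d I g = cls I ` mpoly_piece d g"

text \<open>Graded algebras have degree-\<open>0\<close> piece equal to the base field; this is required of the
  polynomial ring as well as of its quotient.  (For \<open>I = (X - 1)\<close> with \<open>X\<close> of degree \<open>0\<close>, only the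
  condition on the quotient holds.)\<close>

definition graded_algebra ::
  "('x \<Rightarrow> 'g::ab_group_add) \<Rightarrow> ('x, 'k::comm_ring_1) mpoly set \<Rightarrow> bool" where
  "graded_algebra d I \<longleftrightarrow>
     homogeneous_ideal d I \<and>
     (mpoly_piece d 0 :: ('x, 'k) mpoly set) = range mconst \<and>
     bij_betw (\<lambda>c. cls I (mconst c)) UNIV (alg_piece d I 0)"

definition artinian_ring :: "('a, 'b) ring_scheme \<Rightarrow> bool" where
  "artinian_ring R \<longleftrightarrow> ring R \<and>
     (\<forall>J :: nat \<Rightarrow> 'a set. (\<forall>k. ideal (J k) R) \<longrightarrow> (\<forall>k. J (Suc k) \<subseteq> J k) \<longrightarrow>
        (\<exists>N. \<forall>k\<ge>N. J k = J N))"

text \<open>The grading is supported in the positive cone of the ordered group.  Without this the order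
  bears no relation to the grading: \<open>K[X]/(X\<^sup>2)\<close> with \<open>X\<close> of degree \<open>1\<close> in the integers, ordered
  by equality, has socle \<open>A\<^sub>1\<close> but no greatest element.  The condition follows from
  \<open>0 \<le> d i\<close> for all \<open>i\<close>.\<close>

definition positively_graded ::
  "('x \<Rightarrow> 'g::ordered_ab_group_add) \<Rightarrow> ('x, 'k::comm_ring_1) mpoly set \<Rightarrow> bool" where
  "positively_graded d I \<longleftrightarrow> (\<forall>g. alg_piece d I g \<noteq> {\<zero>\<^bsub>quot_alg I\<^esub>} \<longrightarrow> 0 \<le> g)"

section \<open>Linear maps and pairings\<close>

definition alg_scale ::
  "('x, 'k::comm_ring_1) mpoly set \<Rightarrow> 'k \<Rightarrow> ('x, 'k) mpoly set \<Rightarrow> ('x, 'k) mpoly set" where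
  "alg_scale I c a = cls I (mconst c) \<otimes>\<^bsub>quot_alg I\<^esub> a"

text \<open>Linear maps between subspaces \<open>U\<close>, \<open>V\<close> of the algebra are extensional functions, so that
  \<open>alg_Hom I U V\<close> does not distinguish functions that agree on \<open>U\<close>.\<close>

definition alg_Hom ::
  "('x, 'k::field) mpoly set \<Rightarrow> ('x, 'k) mpoly set set \<Rightarrow> ('x, 'k) mpoly set set
     \<Rightarrow> (('x, 'k) mpoly set \<Rightarrow> ('x, 'k) mpoly set) set" where
  "alg_Hom I U V = {\<phi> \<in> U \<rightarrow>\<^sub>E V.
     (\<forall>a\<in>U. \<forall>b\<in>U. \<phi> (a \<oplus>\<^bsub>quot_alg I\<^esub> b) = \<phi> a \<oplus>\<^bsub>quot_alg I\<^esub> \<phi> b) \<and>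
     (\<forall>c. \<forall>a\<in>U. \<phi> (alg_scale I c a) = alg_scale I c (\<phi> a))}"

definition iso_to_field :: "('x, 'k::field) mpoly set \<Rightarrow> ('x, 'k) mpoly set set \<Rightarrow> bool" where
  "iso_to_field I V \<longleftrightarrow> (\<exists>\<phi> :: 'k \<Rightarrow> ('x, 'k) mpoly set. bij_betw \<phi> UNIV V \<and>
     (\<forall>s t. \<phi> (s + t) = \<phi> s \<oplus>\<^bsub>quot_alg I\<^esub> \<phi> t) \<and>
     (\<forall>c s. \<phi> (c * s) = alg_scale I c (\<phi> s)))"

text \<open>The multiplication \<open>U \<times> V \<rightarrow> W\<close> is perfect if both induced maps \<open>U \<rightarrow> Hom(V, W)\<close> and
  \<open>V \<rightarrow> Hom(U, W)\<close> are isomorphisms; their linearity is automatic.\<close>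

definition perfect_mult ::
  "('x, 'k::field) mpoly set \<Rightarrow> ('x, 'k) mpoly set set \<Rightarrow> ('x, 'k) mpoly set set
     \<Rightarrow> ('x, 'k) mpoly set set \<Rightarrow> bool" where
  "perfect_mult I U V W \<longleftrightarrow>
     bij_betw (\<lambda>u. \<lambda>v\<in>V. u \<otimes>\<^bsub>quot_alg I\<^esub> v) U (alg_Hom I V W) \<and>
     bij_betw (\<lambda>v. \<lambda>u\<in>U. u \<otimes>\<^bsub>quot_alg I\<^esub> v) V (alg_Hom I U W)"

section \<open>Cox-Gorenstein algebras and Poincare duality\<close>

definition irrelevant_ideal :: "('x, 'k::comm_ring_1) mpoly set \<Rightarrow> ('x, 'k) mpoly set set" where
  "irrelevant_ideal I = genideal (quot_alg I) (range (\<lambda>i. cls I (mvar i)))"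

definition socle :: "('x, 'k::comm_ring_1) mpoly set \<Rightarrow> ('x, 'k) mpoly set set" where
  "socle I = {a \<in> carrier (quot_alg I).
     \<forall>y\<in>irrelevant_ideal I. a \<otimes>\<^bsub>quot_alg I\<^esub> y = \<zero>\<^bsub>quot_alg I\<^esub>}"

definition cox_gorenstein ::
  "('x \<Rightarrow> 'g::ab_group_add) \<Rightarrow> ('x, 'k::field) mpoly set \<Rightarrow> bool" where
  "cox_gorenstein d I \<longleftrightarrow>
     (\<exists>\<omega>. socle I = alg_piece d I \<omega> \<and> iso_to_field I (alg_piece d I \<omega>))"

definition greatest_piece ::
  "('x \<Rightarrow> 'g::ordered_ab_group_add) \<Rightarrow> ('x, 'k::field) mpoly set \<Rightarrow> 'g \<Rightarrow> bool" where
  "greatest_piece d I \<omega> \<longleftrightarrow>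
     alg_piece d I \<omega> \<noteq> {\<zero>\<^bsub>quot_alg I\<^esub>} \<and>
     (\<forall>g. alg_piece d I g \<noteq> {\<zero>\<^bsub>quot_alg I\<^esub>} \<longrightarrow> g \<le> \<omega>)"

definition poincare_duality ::
  "('x \<Rightarrow> 'g::ordered_ab_group_add) \<Rightarrow> ('x, 'k::field) mpoly set \<Rightarrow> bool" where
  "poincare_duality d I \<longleftrightarrow>
     (\<exists>\<omega>. greatest_piece d I \<omega> \<and> iso_to_field I (alg_piece d I \<omega>) \<and>
        (\<forall>g. alg_piece d I g \<noteq> {\<zero>\<^bsub>quot_alg I\<^esub>} \<longrightarrow>
             alg_piece d I (\<omega> - g) \<noteq> {\<zero>\<^bsub>quot_alg I\<^esub>} \<longrightarrow>
             perfect_mult I (alg_piece d I g) (alg_piece d I (\<omega> - g)) (alg_piece d I \<omega>)) \<and>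
        (\<forall>g. alg_piece d I g = {\<zero>\<^bsub>quot_alg I\<^esub>} \<longleftrightarrow>
             alg_piece d I (\<omega> - g) = {\<zero>\<^bsub>quot_alg I\<^esub>}))"

end

theory Submission
  imports Defs
begin

text \<open>
  Write \<open>A = P / I\<close> with \<open>P\<close> the polynomial ring, and \<open>\<omega>\<close> for the prospective socle degree.
  Positivity of the grading and \<open>P\<^sub>0 = K\<close> together make every variable that survives in \<open>A\<close>
  raise the degree strictly.  Call the multiplication \<open>A\<^sub>g \<times> A\<^sub>h \<rightarrow> A\<^sub>\<omega>\<close> nondegenerate if on either
  side only zero annihilates the other piece.  Both directions reduce to nondegeneracy for
  \<open>h = \<omega> - g\<close>, which by \<open>perfect_mult_iff\<close> is the same as perfection.

  Suppose that the socle is \<open>A\<^sub>\<omega>\<close>.  A nonzero homogeneous \<open>f \<in> A\<^sub>g\<close> can be multiplied by variables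
  only finitely often before it dies, so some homogeneous multiple \<open>f h\<close> is a nonzero element of the
  socle (\<open>exists_multiple_killed_by_mvars\<close>).  Comparing degrees, \<open>h\<close> has degree \<open>\<omega> - g\<close>.  So the
  pairings are nondegenerate, \<open>A\<^sub>g\<close> and \<open>A\<^bsub>\<omega> - g\<^esub>\<close> vanish together, and \<open>0 \<le> \<omega> - g\<close>.

  Conversely, suppose that Poincare duality holds.  Multiplying \<open>A\<^sub>\<omega>\<close> by a variable leaves the
  degrees that occur, so \<open>A\<^sub>\<omega>\<close> lies in the socle.  The homogeneous components of a socle element are
  in the socle; one of degree \<open>g \<noteq> \<omega>\<close> is annihilated by \<open>A\<^bsub>\<omega> - g\<^esub>\<close>, whose elements have no constant
  term, so it is zero by nondegeneracy.

  A nondegenerate pairing is perfect because \<open>A\<close> is Artinian (\<open>bij_betw_pairing\<close>).  A functional on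
  one side can be matched on any finite set by multiplication with an element from the other side
  (\<open>interpolation\<close>), and a finite set with minimal annihilator turns this into agreement
  everywhere.  This takes the place of a dimension count.
\<close>

section \<open>The quotient ring in terms of representatives\<close>

lemma ring_of_type_algebra_simps [simp]:
  "carrier ring_of_type_algebra = UNIV"
  "x \<oplus>\<^bsub>ring_of_type_algebra\<^esub> y = x + y"
  "x \<otimes>\<^bsub>ring_of_type_algebra\<^esub> y = x * y"
  "\<zero>\<^bsub>ring_of_type_algebra\<^esub> = 0"
  "\<one>\<^bsub>ring_of_type_algebra\<^esub> = 1"
  by (simp_all add: ring_of_type_algebra_def)

lemma ideal_ring_of_type_algebraI:
  fixes J :: "'a::comm_ring_1 set"
  assumes "0 \<in> J" "\<And>x y. x \<in> J \<Longrightarrow> y \<in> J \<Longrightarrow> x + y \<in> J" "\<And>x r. x \<in> J \<Longrightarrow> r * x \<in> J"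
  shows "ideal J ring_of_type_algebra"
proof (rule idealI)
  interpret ring "ring_of_type_algebra :: 'a ring"
    by (rule ring_from_type_algebra)
  show "ring (ring_of_type_algebra :: 'a ring)"
    by (rule ring_from_type_algebra)
  show "subgroup J (add_monoid (ring_of_type_algebra :: 'a ring))"
  proof (rule add.subgroupI)
    fix a assume "a \<in> J"
    then have "(- 1) * a \<in> J"
      by (rule assms(3))
    moreover have "\<ominus>\<^bsub>ring_of_type_algebra\<^esub> a = - a"
      by (rule minus_equality) simp_all
    ultimately show "\<ominus>\<^bsub>ring_of_type_algebra\<^esub> a \<in> J"
      by simp
  qed (use assms in auto)
qed (use assms in \<open>auto simp: mult.commute\<close>)

locale polynomial_ideal =
  fixes I :: "('x, 'k::comm_ring_1) mpoly set"
  assumes ideal_I: "ideal I mpoly_ring"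
begin

sublocale ideal I "mpoly_ring :: ('x, 'k) mpoly ring"
  by (rule ideal_I)

sublocale quot: cring "quot_alg I"
  by (rule quotient_is_cring) (rule cring_from_type_algebra)

lemma zero_mem [simp]: "0 \<in> I"
  using additive_subgroup.zero_closed[OF is_additive_subgroup] by simp

lemma add_mem: "f \<in> I \<Longrightarrow> h \<in> I \<Longrightarrow> f + h \<in> I"
  using additive_subgroup.a_closed[OF is_additive_subgroup] by simp

lemma mult_mem_left: "f \<in> I \<Longrightarrow> r * f \<in> I"
  using I_l_closed by simp

lemma mult_mem_right: "f \<in> I \<Longrightarrow> f * r \<in> I"
  using I_r_closed by simp

lemma diff_mem: "f \<in> I \<Longrightarrow> h \<in> I \<Longrightarrow> f - h \<in> I"
  using add_mem[OF _ mult_mem_left[of h "- 1"], of f] by simp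

lemma sum_mem: "(\<And>x. x \<in> S \<Longrightarrow> f x \<in> I) \<Longrightarrow> (\<Sum>x\<in>S. f x) \<in> I"
  by (induction S rule: infinite_finite_induct) (auto intro: add_mem)

lemma mem_cong: "f - h \<in> I \<Longrightarrow> f \<in> I \<longleftrightarrow> h \<in> I"
  using add_mem[of "f - h" h] diff_mem[of f "f - h"] by auto

lemma cls_eq_iff: "cls I f = cls I h \<longleftrightarrow> f - h \<in> I"
  using quotient_eq_iff_same_a_r_cos[OF ideal_I, of f h]
  by (simp add: cls_def a_minus_def minus_equality[of "- h" h])

lemma carrier_quot: "carrier (quot_alg I) = range (cls I)"
  by (auto simp: cls_def FactRing_def A_RCOSETS_def')

lemma cls_mem_carrier [simp]: "cls I f \<in> carrier (quot_alg I)"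
  by (simp add: carrier_quot)

lemma cls_mult [simp]: "cls I f \<otimes>\<^bsub>quot_alg I\<^esub> cls I h = cls I (f * h)"
  using ring_hom_mult[OF rcos_ring_hom, of f h] by (simp add: cls_def)

lemma cls_add [simp]: "cls I f \<oplus>\<^bsub>quot_alg I\<^esub> cls I h = cls I (f + h)"
  using ring_hom_add[OF rcos_ring_hom, of f h] by (simp add: cls_def)

lemma zero_quot: "\<zero>\<^bsub>quot_alg I\<^esub> = cls I 0"
  by (auto simp: FactRing_def cls_def a_r_coset_def')

lemma cls_eq_zero_iff [simp]: "cls I f = \<zero>\<^bsub>quot_alg I\<^esub> \<longleftrightarrow> f \<in> I"
  by (simp add: zero_quot cls_eq_iff)

lemma alg_scale_cls [simp]: "alg_scale I c (cls I f) = cls I (mconst c * f)"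
  by (simp add: alg_scale_def)

text \<open>The polynomials that annihilate \<open>f\<close> modulo \<open>I\<close> form an ideal, so it suffices to test on the
  generators of the irrelevant ideal.\<close>

lemma cls_mem_socle_iff: "cls I f \<in> socle I \<longleftrightarrow> (\<forall>i. f * mvar i \<in> I)"
proof
  assume "cls I f \<in> socle I"
  moreover have "cls I (mvar i) \<in> irrelevant_ideal I" for i
    unfolding irrelevant_ideal_def by (rule subsetD[OF quot.genideal_self]) auto
  ultimately have "cls I f \<otimes>\<^bsub>quot_alg I\<^esub> cls I (mvar i) = \<zero>\<^bsub>quot_alg I\<^esub>" for i
    by (auto simp: socle_def simp del: cls_mult)
  then show "\<forall>i. f * mvar i \<in> I"
    by simp
next
  assume f: "\<forall>i. f * mvar i \<in> I"
  let ?Ann = "{r. f * r \<in> I}"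
  have "ideal ?Ann mpoly_ring"
    by (rule ideal_ring_of_type_algebraI)
      (auto simp: distrib_left mult.left_commute[of f] intro: add_mem mult_mem_left)
  then have "ideal (cls I ` ?Ann) (quot_alg I)"
    unfolding cls_def using ring_ideal_imp_quot_ideal[OF ideal_I] by blast
  then have "irrelevant_ideal I \<subseteq> cls I ` ?Ann"
    unfolding irrelevant_ideal_def using f by (intro quot.genideal_minimal) auto
  then have "cls I f \<otimes>\<^bsub>quot_alg I\<^esub> y = \<zero>\<^bsub>quot_alg I\<^esub>" if y: "y \<in> irrelevant_ideal I" for y
  proof -
    obtain r where "f * r \<in> I" "y = cls I r"
      using \<open>irrelevant_ideal I \<subseteq> cls I ` ?Ann\<close> y by blast
    then show ?thesis
      by simp
  qed
  then show "cls I f \<in> socle I"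
    unfolding socle_def by simp
qed

text \<open>The minimal condition, for a family of ideals of the polynomial ring rather than of the quotient:
  ideals that contain \<open>I\<close> can be recovered from their images.  Families are indexed so that the
  minimal member comes with the data that define it.\<close>

lemma artinian_minimal_ideal:
  assumes artinian: "artinian_ring (quot_alg I)"
    and ne: "S \<noteq> {}"
    and ideals: "\<And>s. s \<in> S \<Longrightarrow> ideal (J s) mpoly_ring"
    and le: "\<And>s. s \<in> S \<Longrightarrow> I \<subseteq> J s"
  shows "\<exists>s\<in>S. \<forall>t\<in>S. J t \<subseteq> J s \<longrightarrow> J t = J s"
proof (rule ccontr)
  assume "\<not> ?thesis"
  then have step: "\<exists>t. t \<in> S \<and> J t \<subset> J s" if "s \<in> S" for s
    using that by blast
  obtain s where s: "\<And>n. s n \<in> S" "\<And>n. J (s (Suc n)) \<subset> J (s n)"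
  proof (atomize_elim, rule dependent_nat_choice[of "\<lambda>_ s. s \<in> S" "\<lambda>_ s t. J t \<subset> J s", simplified all_conj_distrib])
    show "\<exists>s. s \<in> S"
      using ne by blast
  next
    show "\<And>s n. s \<in> S \<Longrightarrow> \<exists>t. t \<in> S \<and> J t \<subset> J s"
      by (rule step)
  qed
  have "\<forall>k. ideal (cls I ` J (s k)) (quot_alg I)"
    unfolding cls_def using ring_ideal_imp_quot_ideal[OF ideal_I ideals] s(1) by blast
  moreover have "\<forall>k. cls I ` J (s (Suc k)) \<subseteq> cls I ` J (s k)"
    using s(2) by (intro allI image_mono) auto
  ultimately have "\<exists>N. \<forall>k\<ge>N. cls I ` J (s k) = cls I ` J (s N)"
    using artinian[unfolded artinian_ring_def, THEN conjunct2, rule_format, of "\<lambda>k. cls I ` J (s k)"]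
    by simp
  then obtain N where N: "\<And>k. k \<ge> N \<Longrightarrow> cls I ` J (s k) = cls I ` J (s N)"
    by blast
  have "J (s N) \<subseteq> J (s (Suc N))"
  proof
    fix x assume "x \<in> J (s N)"
    then have "cls I x \<in> cls I ` J (s (Suc N))"
      using N[of "Suc N"] by auto
    then obtain y where y: "y \<in> J (s (Suc N))" "x - y \<in> I"
      by (auto simp: cls_eq_iff)
    interpret J: polynomial_ideal "J (s (Suc N))"
      by (rule polynomial_ideal.intro[OF ideals[OF s(1)]])
    have "x - y \<in> J (s (Suc N))"
      using y le s by blast
    then show "x \<in> J (s (Suc N))"
      using J.mem_cong y by blast
  qed
  then show False
    using s(2)[of N] by blast
qed

end

section \<open>Homogeneous components\<close>

lemma mdeg_add:
  fixes d :: "'a \<Rightarrow> 'b::ab_group_add"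
  shows "mdeg d (m + n) = mdeg d m + mdeg d n"
proof -
  have eq: "mdeg d p = (\<Sum>i\<in>Poly_Mapping.keys m \<union> Poly_Mapping.keys n. \<Sum>j<Poly_Mapping.lookup p i. d i)"
    if "Poly_Mapping.keys p \<subseteq> Poly_Mapping.keys m \<union> Poly_Mapping.keys n" for p
    unfolding mdeg_def using that
    by (intro sum.mono_neutral_left) (auto simp: in_keys_iff)
  have split: "(\<Sum>j<a + b. x) = (\<Sum>j<a. x) + (\<Sum>j<b. x)" for a b :: nat and x :: 'b
    by (induction b) (auto simp: algebra_simps)
  show ?thesis
    using keys_add[of m n] by (simp add: eq lookup_add split sum.distrib)
qed

lemma mvar_mem_piece: "mvar i \<in> mpoly_piece d (d i)"
  by (auto simp: mvar_def mpoly_piece_def mdeg_def split: if_splits)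

lemma mconst_mem_piece: "mconst c \<in> mpoly_piece d 0"
  by (auto simp: mconst_def mpoly_piece_def mdeg_def split: if_splits)

lemma one_eq_mconst: "1 = mconst 1"
  by (simp add: mconst_def single_one)

lemma zero_mem_piece [simp]: "0 \<in> mpoly_piece d g"
  by (simp add: mpoly_piece_def)

lemma add_mem_piece: "f \<in> mpoly_piece d g \<Longrightarrow> h \<in> mpoly_piece d g \<Longrightarrow> f + h \<in> mpoly_piece d g"
  using keys_add[of f h] by (auto simp: mpoly_piece_def)

lemma diff_mem_piece: "f \<in> mpoly_piece d g \<Longrightarrow> h \<in> mpoly_piece d g \<Longrightarrow> f - h \<in> mpoly_piece d g"
  by (fastforce simp: mpoly_piece_def in_keys_iff lookup_minus)

lemma mult_mem_piece:
  "f \<in> mpoly_piece d g \<Longrightarrow> h \<in> mpoly_piece d g' \<Longrightarrow> f * h \<in> mpoly_piece d (g + g')"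
  using keys_mult[of f h] by (fastforce simp: mpoly_piece_def mdeg_add)

lemma scale_mem_piece: "f \<in> mpoly_piece d g \<Longrightarrow> mconst c * f \<in> mpoly_piece d g"
  using mult_mem_piece[OF mconst_mem_piece] by fastforce

lemma lookup_component:
  "Poly_Mapping.lookup (mpoly_component d g f) m = (if mdeg d m = g then Poly_Mapping.lookup f m else 0)"
proof -
  have "Poly_Mapping.lookup (mpoly_component d g f) m =
    (\<Sum>n\<in>{n \<in> Poly_Mapping.keys f. mdeg d n = g}. if n = m then Poly_Mapping.lookup f n else 0)"
    unfolding mpoly_component_def by (simp add: lookup_sum lookup_single when_def)
  also have "\<dots> = (if mdeg d m = g then Poly_Mapping.lookup f m else 0)"
    by (auto simp: in_keys_iff)
  finally show ?thesis .
qed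

lemma component_mem_piece [simp]: "mpoly_component d g f \<in> mpoly_piece d g"
  by (auto simp: mpoly_piece_def in_keys_iff lookup_component split: if_splits)

lemma component_of_piece:
  "f \<in> mpoly_piece d g \<Longrightarrow> mpoly_component d h f = (if h = g then f else 0)"
  by (rule poly_mapping_eqI) (auto simp: lookup_component mpoly_piece_def in_keys_iff)

lemma component_zero [simp]: "mpoly_component d g 0 = 0"
  by (rule poly_mapping_eqI) (auto simp: lookup_component)

lemma component_add: "mpoly_component d g (f + h) = mpoly_component d g f + mpoly_component d g h"
  by (rule poly_mapping_eqI) (auto simp: lookup_component lookup_add)

lemma component_diff:
  "mpoly_component d g (f - h) = mpoly_component d g f - mpoly_component d g h"
  by (rule poly_mapping_eqI) (auto simp: lookup_component lookup_minus)

lemma component_sum: "mpoly_component d g (\<Sum>x\<in>S. f x) = (\<Sum>x\<in>S. mpoly_component d g (f x))"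
  by (induction S rule: infinite_finite_induct) (auto simp: component_add)

lemma sum_components:
  "(\<Sum>g\<in>mdeg d ` Poly_Mapping.keys f. mpoly_component d g f) = f"
  by (rule poly_mapping_eqI) (auto simp: lookup_sum lookup_component in_keys_iff)

lemma component_mult:
  assumes "f \<in> mpoly_piece d g"
  shows "mpoly_component d h (f * r) = f * mpoly_component d (h - g) r"
proof -
  have "mpoly_component d h (f * r) =
      mpoly_component d h (\<Sum>k\<in>mdeg d ` Poly_Mapping.keys r. f * mpoly_component d k r)"
    by (simp add: sum_components flip: sum_distrib_left)
  also have "\<dots> = (\<Sum>k\<in>mdeg d ` Poly_Mapping.keys r. if h = g + k then f * mpoly_component d k r else 0)"
    unfolding component_sum
    by (intro sum.cong refl component_of_piece mult_mem_piece assms component_mem_piece)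
  also have "\<dots> = (\<Sum>k\<in>mdeg d ` Poly_Mapping.keys r. f * mpoly_component d (h - g) (mpoly_component d k r))"
    by (intro sum.cong refl) (auto simp: component_of_piece[OF component_mem_piece] algebra_simps)
  also have "\<dots> = f * mpoly_component d (h - g) r"
    by (simp add: sum_components flip: sum_distrib_left component_sum)
  finally show ?thesis .
qed

lemma component_scale: "mpoly_component d g (mconst c * f) = mconst c * mpoly_component d g f"
  using component_mult[OF mconst_mem_piece] by simp

section \<open>Interpolation by a pairing\<close>

text \<open>A functional that vanishes on the common kernel of finitely many functionals is a combination of
  them.  In the induction, if \<open>F s\<close> is not already redundant, it takes the value \<open>1\<close> at some
  \<open>u0\<close> in the kernel of the others, and \<open>f - f u0 * F s\<close> vanishes on that whole kernel.\<close>

lemma functional_in_span: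
  fixes scale :: "'k::field \<Rightarrow> 'a::ab_group_add \<Rightarrow> 'a"
  assumes "finite T" "\<And>t. t \<in> T \<Longrightarrow> Vector_Spaces.linear scale (*) (F t)" "Vector_Spaces.linear scale (*) f"
    and "\<And>u. (\<forall>t\<in>T. F t u = 0) \<Longrightarrow> f u = 0"
  shows "\<exists>c. \<forall>u. f u = (\<Sum>t\<in>T. c t * F t u)"
  using assms
proof (induction T arbitrary: f rule: finite_induct)
  case empty
  then show ?case by auto
next
  case (insert s T)
  interpret f: Vector_Spaces.linear scale "(*)" f by fact
  interpret s: Vector_Spaces.linear scale "(*)" "F s" using insert.prems(1) by blast
  show ?case
  proof (cases "\<forall>u. (\<forall>t\<in>T. F t u = 0) \<longrightarrow> F s u = 0")
    case True
    then obtain c where c: "\<forall>u. f u = (\<Sum>t\<in>T. c t * F t u)"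
      using insert.IH[of f] insert.prems by auto
    have "f u = (\<Sum>t\<in>insert s T. (c(s := 0)) t * F t u)" for u
      using insert.hyps c by (simp, intro sum.cong) auto
    then show ?thesis by blast
  next
    case False
    then obtain u1 where u1: "\<forall>t\<in>T. F t u1 = 0" "F s u1 \<noteq> 0" by blast
    define u0 where "u0 = scale (inverse (F s u1)) u1"
    have u0: "F t u0 = 0" if "t \<in> T" for t
    proof -
      interpret t: Vector_Spaces.linear scale "(*)" "F t" using insert.prems(1) that by blast
      show ?thesis using u1 that by (simp add: u0_def t.scale)
    qed
    have u0s: "F s u0 = 1" using u1 by (simp add: u0_def s.scale)
    have "f u = f u0 * F s u" if "\<forall>t\<in>T. F t u = 0" for u
    proof -
      have "f (u - scale (F s u) u0) = 0"
      proof (rule insert.prems(3), rule ballI)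
        fix t assume t: "t \<in> insert s T"
        interpret t: Vector_Spaces.linear scale "(*)" "F t" using insert.prems(1) t by blast
        show "F t (u - scale (F s u) u0) = 0"
          using t that u0 u0s by (auto simp: t.diff t.scale)
      qed
      then show ?thesis by (simp add: f.diff f.scale)
    qed
    moreover have "Vector_Spaces.linear scale (*) (\<lambda>u. f u - f u0 * F s u)"
      by unfold_locales (simp_all only: f.add s.add f.scale s.scale distrib_left add_diff_add
          right_diff_distrib mult.left_commute)
    ultimately obtain c where c: "\<And>u. f u - f u0 * F s u = (\<Sum>t\<in>T. c t * F t u)"
      using insert.IH[of "\<lambda>u. f u - f u0 * F s u"] insert.prems(1) by auto
    have "f u = (\<Sum>t\<in>insert s T. (c(s := f u0)) t * F t u)" for u
    proof -
      have "(\<Sum>t\<in>T. (c(s := f u0)) t * F t u) = (\<Sum>t\<in>T. c t * F t u)"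
        using insert.hyps by (intro sum.cong) auto
      moreover have "f u = f u0 * F s u + (\<Sum>t\<in>T. c t * F t u)"
        using c[of u] by (metis add.commute diff_eq_eq)
      ultimately show ?thesis using insert.hyps by simp
    qed
    then show ?thesis by blast
  qed
qed

text \<open>Any functional on the second space that respects the radical of \<open>B\<close> is represented, on finitely
  many vectors at a time, by a vector of the first space.  When a vector \<open>s\<close> is added to \<open>T\<close>, either
  some \<open>u'\<close> orthogonal to \<open>T\<close> can be used to correct the value at \<open>s\<close>, or \<open>s\<close> is a
  combination of \<open>T\<close> modulo the radical and its value is already right.\<close>

lemma interpolation:
  fixes scale1 :: "'k::field \<Rightarrow> 'a::ab_group_add \<Rightarrow> 'a"
    and scale2 :: "'k \<Rightarrow> 'b::ab_group_add \<Rightarrow> 'b"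
  assumes "finite T"
    and lin1: "\<And>v. Vector_Spaces.linear scale1 (*) (\<lambda>u. B u v)"
    and lin2: "\<And>u. Vector_Spaces.linear scale2 (*) (B u)"
    and psi: "Vector_Spaces.linear scale2 (*) \<psi>"
    and radical: "\<And>v. (\<And>u. B u v = 0) \<Longrightarrow> \<psi> v = 0"
  shows "\<exists>u. \<forall>t\<in>T. B u t = \<psi> t"
  using \<open>finite T\<close>
proof (induction T rule: finite_induct)
  case empty
  then show ?case by simp
next
  case (insert s T)
  then obtain u where u: "\<forall>t\<in>T. B u t = \<psi> t" by blast
  interpret psi: Vector_Spaces.linear scale2 "(*)" \<psi> by fact
  interpret s: Vector_Spaces.linear scale1 "(*)" "\<lambda>u. B u s" by (rule lin1)
  show ?case
  proof (cases "\<exists>u'. (\<forall>t\<in>T. B u' t = 0) \<and> B u' s \<noteq> 0")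
    case True
    then obtain u' where u': "\<And>t. t \<in> T \<Longrightarrow> B u' t = 0" "B u' s \<noteq> 0" by blast
    define w where "w = u + scale1 ((\<psi> s - B u s) / B u' s) u'"
    have "B w t = B u t + (\<psi> s - B u s) / B u' s * B u' t" for t
    proof -
      interpret t: Vector_Spaces.linear scale1 "(*)" "\<lambda>u. B u t" by (rule lin1)
      show ?thesis by (simp add: w_def t.add t.scale)
    qed
    then have "\<forall>t\<in>insert s T. B w t = \<psi> t" using u u' by auto
    then show ?thesis by blast
  next
    case False
    then obtain c where c: "\<And>x. B x s = (\<Sum>t\<in>T. c t * B x t)"
      using functional_in_span[of T scale1 "\<lambda>t u. B u t" "\<lambda>u. B u s"] insert.hyps lin1 by blast
    have "\<psi> (s - (\<Sum>t\<in>T. scale2 (c t) t)) = 0"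
    proof (rule radical)
      fix x
      interpret x: Vector_Spaces.linear scale2 "(*)" "B x" by (rule lin2)
      show "B x (s - (\<Sum>t\<in>T. scale2 (c t) t)) = 0"
        using c[of x] by (simp add: x.diff x.sum x.scale)
    qed
    then have "\<psi> s = B u s"
      using u c[of u] by (simp add: psi.diff psi.sum psi.scale)
    then show ?thesis using u by auto
  qed
qed


lemma vector_space_mpoly: "vector_space (\<lambda>c (f :: ('x, 'k::field) mpoly). mconst c * f)"
  by unfold_locales
    (auto simp: algebra_simps mconst_def single_add mult_single single_one)

lemma linear_mpolyI:
  fixes f :: "('x, 'k::field) mpoly \<Rightarrow> 'k"
  assumes "\<And>p q. f (p + q) = f p + f q" "\<And>c p. f (mconst c * p) = c * f p"
  shows "Vector_Spaces.linear (\<lambda>c p. mconst c * p) (*) f"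
proof -
  interpret vector_space "\<lambda>c (f :: ('x, 'k) mpoly). mconst c * f"
    by (rule vector_space_mpoly)
  show ?thesis
    by unfold_locales (simp_all add: assms distrib_left distrib_right)
qed

section \<open>Positively graded quotients\<close>

locale positively_graded_quotient =
  fixes d :: "'x \<Rightarrow> 'g::ordered_ab_group_add"
    and I :: "('x, 'k::field) mpoly set"
  assumes graded: "graded_algebra d I"
    and positive: "positively_graded d I"
begin

sublocale polynomial_ideal I
  using graded by (intro polynomial_ideal.intro) (auto simp: graded_algebra_def homogeneous_ideal_def)

lemma component_mem: "f \<in> I \<Longrightarrow> mpoly_component d g f \<in> I"
  using graded by (auto simp: graded_algebra_def homogeneous_ideal_def)

lemma one_notin: "1 \<notin> I"
proof
  assume "1 \<in> I"
  then have "cls I (mconst 1) = cls I (mconst 0)"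
    by (simp add: cls_eq_iff mconst_def single_one)
  moreover have "inj (\<lambda>c. cls I (mconst c))"
    using graded by (auto simp: graded_algebra_def bij_betw_def)
  ultimately show False
    by (auto dest: injD)
qed

lemma mem_if_components_mem: "(\<And>g. mpoly_component d g f \<in> I) \<Longrightarrow> f \<in> I"
  using sum_mem[of "mdeg d ` Poly_Mapping.keys f" "\<lambda>g. mpoly_component d g f"]
  by (simp add: sum_components)

text \<open>A polynomial without constant term lies in the ideal generated by the variables.\<close>

lemma mult_mem_if_no_constant_term:
  assumes kills: "\<And>i. p * mvar i \<in> I" and v: "Poly_Mapping.lookup v 0 = 0"
  shows "p * v \<in> I"
proof -
  have monomial: "p * Poly_Mapping.single m c \<in> I" if "m \<noteq> 0" for m c
  proof -
    have "\<exists>i. Poly_Mapping.lookup m i \<noteq> 0"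
      using that by (auto simp: poly_mapping_eq_iff fun_eq_iff)
    then obtain i where i: "Poly_Mapping.lookup m i \<noteq> 0"
      by blast
    have "m = Poly_Mapping.single i 1 + (m - Poly_Mapping.single i 1)"
      using i by (intro poly_mapping_eqI) (auto simp: lookup_add lookup_minus lookup_single when_def)
    then have "Poly_Mapping.single m c = mvar i * Poly_Mapping.single (m - Poly_Mapping.single i 1) c"
      unfolding mvar_def by (simp add: mult_single)
    then show ?thesis
      using mult_mem_right[OF kills[of i]] by (simp add: mult.assoc)
  qed
  have "v = (\<Sum>m\<in>Poly_Mapping.keys v. Poly_Mapping.single m (Poly_Mapping.lookup v m))"
    by (rule poly_mapping_eqI) (auto simp: lookup_sum lookup_single when_def in_keys_iff)
  then have "p * v = (\<Sum>m\<in>Poly_Mapping.keys v. p * Poly_Mapping.single m (Poly_Mapping.lookup v m))"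
    by (metis sum_distrib_left)
  also have "\<dots> \<in> I"
    using v by (intro sum_mem monomial) (auto simp: in_keys_iff)
  finally show ?thesis .
qed

lemma alg_piece_eq_zero_iff:
  "alg_piece d I g = {\<zero>\<^bsub>quot_alg I\<^esub>} \<longleftrightarrow> mpoly_piece d g \<subseteq> I"
proof -
  have "cls I 0 \<in> alg_piece d I g"
    unfolding alg_piece_def by simp
  then have "alg_piece d I g = {\<zero>\<^bsub>quot_alg I\<^esub>} \<longleftrightarrow> (\<forall>a\<in>alg_piece d I g. a = \<zero>\<^bsub>quot_alg I\<^esub>)"
    by auto
  also have "\<dots> \<longleftrightarrow> mpoly_piece d g \<subseteq> I"
    by (auto simp: alg_piece_def)
  finally show ?thesis .
qed

lemma degree_nonneg: "f \<in> mpoly_piece d g \<Longrightarrow> f \<notin> I \<Longrightarrow> 0 \<le> g"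
  using positive alg_piece_eq_zero_iff by (fastforce simp: positively_graded_def)

text \<open>A variable of degree \<open>0\<close> would be a constant, since the degree \<open>0\<close> piece of the polynomial
  ring is the field.\<close>

lemma degree_mvar_nonzero: "d i \<noteq> 0"
proof
  assume "d i = 0"
  then have "(mvar i :: ('x, 'k) mpoly) \<in> range mconst"
    using mvar_mem_piece[of i d] graded by (auto simp: graded_algebra_def)
  then obtain c where "(mvar i :: ('x, 'k) mpoly) = mconst c" by blast
  then have "Poly_Mapping.lookup (mvar i :: ('x, 'k) mpoly) (Poly_Mapping.single i 1)
      = Poly_Mapping.lookup (mconst c) (Poly_Mapping.single i 1)"
    by simp
  moreover have "Poly_Mapping.single i (1::nat) \<noteq> 0"
    by (metis keys_single keys_zero insert_not_empty zero_neq_one)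
  ultimately show False
    by (simp add: mvar_def mconst_def lookup_single)
qed

text \<open>The form in which strict positivity is used: if neither factor is in \<open>I\<close>, then \<open>d i\<close> and
  \<open>- d i\<close> are both nonnegative.\<close>

lemma mult_mvar_mem:
  assumes "r \<in> mpoly_piece d g" "g \<le> - d i"
  shows "mvar i * r \<in> I"
proof (rule ccontr)
  assume *: "mvar i * r \<notin> I"
  then have "0 \<le> d i" "0 \<le> g"
    using degree_nonneg[OF mvar_mem_piece] degree_nonneg[OF assms(1)]
    by (blast intro: mult_mem_left mult_mem_right)+
  then have "d i = 0"
    using assms(2) by (metis neg_0_le_iff_le order.trans order.antisym)
  then show False
    using degree_mvar_nonzero by blast
qed

text \<open>Among the ideals \<open>(f h) + I\<close> with \<open>h\<close> homogeneous and \<open>f h \<notin> I\<close>, take a minimal one.  If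
  \<open>f h X\<^sub>i \<notin> I\<close>, minimality gives \<open>f h \<equiv> f h X\<^sub>i r\<close>, where \<open>r\<close> may be replaced by its component of
  degree \<open>- d i\<close>; but then \<open>X\<^sub>i r \<in> I\<close>.\<close>

lemma exists_multiple_killed_by_mvars:
  assumes artinian: "artinian_ring (quot_alg I)"
    and f: "f \<in> mpoly_piece d g" "f \<notin> I"
  shows "\<exists>k. \<exists>h\<in>mpoly_piece d k. f * h \<notin> I \<and> (\<forall>i. f * h * mvar i \<in> I)"
proof -
  define S where "S = {h. (\<exists>k. h \<in> mpoly_piece d k) \<and> f * h \<notin> I}"
  define J where "J h = {p. \<exists>r. p - f * h * r \<in> I}" for h
  have "1 \<in> S"
    using f mconst_mem_piece[of 1 d] by (auto simp: S_def one_eq_mconst[symmetric])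
  moreover have "ideal (J h) mpoly_ring" for h
  proof (rule ideal_ring_of_type_algebraI)
    show "0 \<in> J h"
      by (auto simp: J_def intro: exI[of _ 0])
  next
    fix x y assume "x \<in> J h" "y \<in> J h"
    then obtain r s where "x - f * h * r \<in> I" "y - f * h * s \<in> I"
      by (auto simp: J_def)
    then have "(x + y) - f * h * (r + s) \<in> I"
      using add_mem[of "x - f * h * r" "y - f * h * s"] by (simp add: algebra_simps)
    then show "x + y \<in> J h"
      by (auto simp: J_def)
  next
    fix x s assume "x \<in> J h"
    then obtain r where "x - f * h * r \<in> I"
      by (auto simp: J_def)
    then have "s * x - f * h * (s * r) \<in> I"
      using mult_mem_left[of "x - f * h * r" s] by (simp add: algebra_simps)
    then show "s * x \<in> J h"
      by (auto simp: J_def)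
  qed
  moreover have "I \<subseteq> J h" for h
    by (auto simp: J_def intro: exI[of _ 0])
  ultimately obtain h where h: "h \<in> S" "\<And>t. t \<in> S \<Longrightarrow> J t \<subseteq> J h \<Longrightarrow> J t = J h"
    using artinian_minimal_ideal[OF artinian, of S J] by blast
  then obtain k where k: "h \<in> mpoly_piece d k" and fh: "f * h \<notin> I"
    by (auto simp: S_def)
  have "f * h * mvar i \<in> I" for i
  proof (rule ccontr)
    assume *: "f * h * mvar i \<notin> I"
    then have "h * mvar i \<in> S"
      using mult_mem_piece[OF k mvar_mem_piece] by (auto simp: S_def mult.assoc)
    moreover have "J (h * mvar i) \<subseteq> J h"
      by (auto simp: J_def mult.assoc)
    moreover have "f * h \<in> J h"
      by (auto simp: J_def intro: exI[of _ 1])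
    ultimately have "f * h \<in> J (h * mvar i)"
      using h(2) by blast
    then obtain r where r: "f * h - (f * h * mvar i) * r \<in> I"
      by (auto simp: J_def mult.assoc)
    have fhp: "f * h \<in> mpoly_piece d (g + k)"
      using f k by (intro mult_mem_piece)
    have "mpoly_component d (g + k) (f * h - (f * h * mvar i) * r) =
        f * h - f * h * (mvar i * mpoly_component d (- d i) r)"
      using component_mult[OF mult_mem_piece[OF fhp mvar_mem_piece[of i]], of "g + k" r]
      by (simp add: component_diff component_of_piece[OF fhp] mult.assoc)
    then have "f * h - f * h * (mvar i * mpoly_component d (- d i) r) \<in> I"
      using component_mem[OF r] by metis
    moreover have "f * h * (mvar i * mpoly_component d (- d i) r) \<in> I"
      by (intro mult_mem_left mult_mvar_mem[OF component_mem_piece]) simp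
    ultimately show False
      using fh mem_cong by blast
  qed
  then show ?thesis
    using k fh by blast
qed

end

section \<open>Perfect pairings and nondegeneracy\<close>

context positively_graded_quotient
begin

text \<open>An isomorphism of a piece with the field, inverted: it serves to make the pairing and the
  homomorphisms into the piece scalar-valued.\<close>

lemma alg_piece_coordinate:
  assumes "iso_to_field I (alg_piece d I \<omega>)"
  obtains L where
    "\<And>a b. a \<in> alg_piece d I \<omega> \<Longrightarrow> b \<in> alg_piece d I \<omega> \<Longrightarrow> L a = L b \<Longrightarrow> a = b"
    "\<And>a b. a \<in> alg_piece d I \<omega> \<Longrightarrow> b \<in> alg_piece d I \<omega> \<Longrightarrow> L (a \<oplus>\<^bsub>quot_alg I\<^esub> b) = L a + L b"
    "\<And>c a. a \<in> alg_piece d I \<omega> \<Longrightarrow> L (alg_scale I c a) = c * L a"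
proof -
  obtain \<theta> :: "'k \<Rightarrow> ('x, 'k) mpoly set" where \<theta>: "bij_betw \<theta> UNIV (alg_piece d I \<omega>)"
    "\<And>s t. \<theta> (s + t) = \<theta> s \<oplus>\<^bsub>quot_alg I\<^esub> \<theta> t" "\<And>c s. \<theta> (c * s) = alg_scale I c (\<theta> s)"
    using assms unfolding iso_to_field_def by blast
  define \<kappa> where "\<kappa> = inv_into UNIV \<theta>"
  have inv: "\<kappa> (\<theta> s) = s" for s
    using \<theta>(1) by (simp add: \<kappa>_def bij_betw_def)
  have inv': "\<theta> (\<kappa> a) = a" if "a \<in> alg_piece d I \<omega>" for a
    using that \<theta>(1) unfolding \<kappa>_def by (metis bij_betw_def f_inv_into_f)
  have inj: "a = b" if "a \<in> alg_piece d I \<omega>" "b \<in> alg_piece d I \<omega>" "\<kappa> a = \<kappa> b" for a b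
    by (rule trans[OF inv'[OF that(1), symmetric]]) (simp only: that(3) inv'[OF that(2)])
  have add: "\<kappa> (a \<oplus>\<^bsub>quot_alg I\<^esub> b) = \<kappa> a + \<kappa> b"
    if "a \<in> alg_piece d I \<omega>" "b \<in> alg_piece d I \<omega>" for a b
  proof -
    have "\<kappa> (a \<oplus>\<^bsub>quot_alg I\<^esub> b) = \<kappa> (\<theta> (\<kappa> a + \<kappa> b))"
      by (simp only: \<theta>(2) inv'[OF that(1)] inv'[OF that(2)])
    then show ?thesis
      by (simp only: inv)
  qed
  have scale: "\<kappa> (alg_scale I c a) = c * \<kappa> a" if "a \<in> alg_piece d I \<omega>" for c a
  proof -
    have "\<kappa> (alg_scale I c a) = \<kappa> (\<theta> (c * \<kappa> a))"
      by (simp only: \<theta>(3) inv'[OF that])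
    then show ?thesis
      by (simp only: inv)
  qed
  show ?thesis
    by (rule that[of \<kappa>]) (fact inj add scale)+
qed

text \<open>Surjectivity is the substantial part.  The pairing is extended to all polynomials \<open>u\<close> and \<open>v\<close>
  through their components of degree \<open>g\<close> and \<open>h\<close>, which keeps the linear algebra on a type; the
  radical consists, by nondegeneracy, of the polynomials whose component is in \<open>I\<close>.  The
  annihilators of finite sets \<open>T\<close> of such \<open>v\<close> are ideals; let \<open>T\<close> have a minimal one and let \<open>u\<close>
  represent the homomorphism on \<open>T\<close>.  For any further \<open>v\<close>, a representative \<open>u'\<close> on
  \<open>insert v T\<close> differs from \<open>u\<close> by an element that kills \<open>T\<close>, hence kills \<open>v\<close>, and so \<open>u\<close> is right
  at \<open>v\<close> as well.\<close>

lemma bij_betw_pairing: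
  assumes artinian: "artinian_ring (quot_alg I)"
    and iso: "iso_to_field I (alg_piece d I (g + h))"
    and left: "\<And>u. u \<in> mpoly_piece d g \<Longrightarrow> (\<And>v. v \<in> mpoly_piece d h \<Longrightarrow> u * v \<in> I) \<Longrightarrow> u \<in> I"
    and right: "\<And>v. v \<in> mpoly_piece d h \<Longrightarrow> (\<And>u. u \<in> mpoly_piece d g \<Longrightarrow> u * v \<in> I) \<Longrightarrow> v \<in> I"
  shows "bij_betw (\<lambda>u. \<lambda>v\<in>alg_piece d I h. u \<otimes>\<^bsub>quot_alg I\<^esub> v) (alg_piece d I g)
    (alg_Hom I (alg_piece d I h) (alg_piece d I (g + h)))"
    (is "bij_betw ?M ?U ?H")
proof (rule bij_betwI')
  fix a b assume "a \<in> ?U" "b \<in> ?U"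
  then obtain p q where ab: "p \<in> mpoly_piece d g" "q \<in> mpoly_piece d g" "a = cls I p" "b = cls I q"
    by (auto simp: alg_piece_def)
  show "?M a = ?M b \<longleftrightarrow> a = b"
  proof
    assume eq: "?M a = ?M b"
    have "p - q \<in> I"
    proof (rule left)
      show "p - q \<in> mpoly_piece d g"
        using ab by (intro diff_mem_piece)
    next
      fix v :: "('x, 'k) mpoly" assume "v \<in> mpoly_piece d h"
      then have "cls I (p * v) = cls I (q * v)"
        using fun_cong[OF eq, of "cls I v"] ab by (simp add: alg_piece_def)
      then show "(p - q) * v \<in> I"
        by (simp add: cls_eq_iff left_diff_distrib)
    qed
    then show "a = b"
      using ab by (simp add: cls_eq_iff)
  qed simp
next
  fix a assume "a \<in> ?U"
  then obtain p where p: "p \<in> mpoly_piece d g" "a = cls I p"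
    by (auto simp: alg_piece_def)
  show "?M a \<in> ?H"
    using p by (auto simp: alg_Hom_def alg_piece_def distrib_left mult.left_commute
        intro: mult_mem_piece add_mem_piece scale_mem_piece)
next
  fix \<phi> assume \<phi>: "\<phi> \<in> ?H"
  obtain L where
    L_inj: "\<And>a b. a \<in> alg_piece d I (g + h) \<Longrightarrow> b \<in> alg_piece d I (g + h) \<Longrightarrow> L a = L b \<Longrightarrow> a = b" and
    L_add: "\<And>a b. a \<in> alg_piece d I (g + h) \<Longrightarrow> b \<in> alg_piece d I (g + h) \<Longrightarrow>
      L (a \<oplus>\<^bsub>quot_alg I\<^esub> b) = L a + L b" and
    L_scale: "\<And>c a. a \<in> alg_piece d I (g + h) \<Longrightarrow> L (alg_scale I c a) = c * L a"
    using alg_piece_coordinate[OF iso] by blast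
  let ?c = "mpoly_component d"
  \<comment> \<open>Going through components makes these total functions, linear on all polynomials.\<close>
  define B where "B u v = L (cls I (?c g u * ?c h v))" for u v
  define \<psi> where "\<psi> v = L (\<phi> (cls I (?c h v)))" for v
  have cls_mem: "cls I p \<in> alg_piece d I k" if "p \<in> mpoly_piece d k" for p k
    using that by (auto simp: alg_piece_def)
  have prod_mem: "cls I (?c g u * ?c h v) \<in> alg_piece d I (g + h)" for u v
    by (intro cls_mem mult_mem_piece component_mem_piece)
  have \<phi>_mem: "\<phi> (cls I (?c h v)) \<in> alg_piece d I (g + h)" for v
    using \<phi> cls_mem[OF component_mem_piece] by (auto simp: alg_Hom_def)
  have B_add1: "B (u + u') v = B u v + B u' v" and B_add2: "B u (v + v') = B u v + B u v'" for u u' v v'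
    using L_add[OF prod_mem prod_mem] by (auto simp: B_def component_add algebra_simps)
  have B_scale1: "B (mconst c * u) v = c * B u v" for c u v
    using L_scale[OF prod_mem, of c u v] by (simp add: B_def component_scale mult.assoc)
  have B_scale2: "B u (mconst c * v) = c * B u v" for c u v
    using L_scale[OF prod_mem, of c u v] by (simp add: B_def component_scale mult.left_commute)
  have \<phi>_add: "\<phi> (a \<oplus>\<^bsub>quot_alg I\<^esub> b) = \<phi> a \<oplus>\<^bsub>quot_alg I\<^esub> \<phi> b"
    if "a \<in> alg_piece d I h" "b \<in> alg_piece d I h" for a b
    using \<phi> that unfolding alg_Hom_def by blast
  have \<phi>_scale: "\<phi> (alg_scale I c a) = alg_scale I c (\<phi> a)" if "a \<in> alg_piece d I h" for c a
    using \<phi> that unfolding alg_Hom_def by blast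
  have \<psi>_add: "\<psi> (v + v') = \<psi> v + \<psi> v'" for v v'
    unfolding \<psi>_def component_add cls_add[symmetric]
    by (simp only: \<phi>_add[OF cls_mem cls_mem, OF component_mem_piece component_mem_piece] L_add[OF \<phi>_mem \<phi>_mem])
  have \<psi>_scale: "\<psi> (mconst c * v) = c * \<psi> v" for c v
    unfolding \<psi>_def component_scale alg_scale_cls[symmetric]
    by (simp only: \<phi>_scale[OF cls_mem, OF component_mem_piece] L_scale[OF \<phi>_mem])
  have L_zero: "L (cls I 0) = 0"
    using L_scale[OF cls_mem[OF zero_mem_piece], of 0] by simp
  have B_zero_iff: "B u v = 0 \<longleftrightarrow> ?c g u * ?c h v \<in> I" for u v
  proof -
    have "B u v = 0 \<longleftrightarrow> cls I (?c g u * ?c h v) = cls I 0"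
      unfolding B_def using L_inj[OF prod_mem cls_mem[OF zero_mem_piece]] L_zero by metis
    then show ?thesis
      by (simp add: cls_eq_iff)
  qed
  have \<psi>_radical: "\<psi> v = 0" if "\<And>u. B u v = 0" for v
  proof -
    have "?c h v \<in> I"
    proof (rule right)
      fix u :: "('x, 'k) mpoly" assume "u \<in> mpoly_piece d g"
      then show "u * ?c h v \<in> I"
        using that[of u] by (simp add: B_zero_iff component_of_piece)
    qed simp
    then have "cls I (?c h v) = cls I (mconst 0 * 0)"
      by (simp add: cls_eq_iff)
    then have "\<psi> v = \<psi> (mconst 0 * 0)"
      by (simp add: \<psi>_def)
    then show ?thesis
      using \<psi>_scale[of 0 0] by simp
  qed
  have interpolate: "\<exists>u. \<forall>t\<in>T. B u t = \<psi> t" if "finite T" for T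
    by (rule interpolation[OF that linear_mpolyI linear_mpolyI linear_mpolyI])
      (auto simp: B_add1 B_add2 B_scale1 B_scale2 \<psi>_add \<psi>_scale \<psi>_radical)
  define J where "J T = {u. \<forall>t\<in>T. u * ?c h t \<in> I}" for T
  have "ideal (J T) mpoly_ring" for T
    by (rule ideal_ring_of_type_algebraI)
      (auto simp: J_def distrib_right mult.assoc intro: add_mem mult_mem_left)
  moreover have "I \<subseteq> J T" for T
    by (auto simp: J_def intro: mult_mem_right)
  ultimately obtain T where T: "finite T" and T_min: "\<And>T'. finite T' \<Longrightarrow> J T' \<subseteq> J T \<Longrightarrow> J T' = J T"
    using artinian_minimal_ideal[OF artinian, of "Collect finite" J] by blast
  obtain u where u: "\<And>t. t \<in> T \<Longrightarrow> B u t = \<psi> t"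
    using interpolate[OF T] by blast
  have Bu: "B u v = \<psi> v" for v
  proof -
    obtain u' where u': "\<And>t. t \<in> insert v T \<Longrightarrow> B u' t = \<psi> t"
      using interpolate[of "insert v T"] T by blast
    have B_diff: "B (u - u') t = B u t - B u' t" for t
      using B_add1[of "u - u'" u' t] by simp
    have "B (u - u') t = 0" if "t \<in> T" for t
      using u u' that by (simp add: B_diff)
    then have "?c g (u - u') \<in> J T"
      by (auto simp: J_def B_zero_iff)
    also have "J T = J (insert v T)"
      using T by (intro T_min[symmetric]) (auto simp: J_def)
    finally have "B (u - u') v = 0"
      by (simp add: J_def B_zero_iff)
    then show ?thesis
      using u'[of v] by (simp add: B_diff)
  qed
  have "\<phi> = ?M (cls I (?c g u))"
  proof
    fix a
    show "\<phi> a = ?M (cls I (?c g u)) a"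
    proof (cases "a \<in> alg_piece d I h")
      case True
      then obtain v where v: "v \<in> mpoly_piece d h" "a = cls I v"
        by (auto simp: alg_piece_def)
      then have cv: "?c h v = v"
        by (simp add: component_of_piece)
      have "cls I (?c g u * ?c h v) = \<phi> (cls I (?c h v))"
        using Bu[of v] by (intro L_inj[OF prod_mem \<phi>_mem]) (simp add: B_def \<psi>_def)
      then show ?thesis
        using True v cv by simp
    next
      case False
      then show ?thesis
        using \<phi> by (auto simp: alg_Hom_def PiE_def extensional_def)
    qed
  qed
  then show "\<exists>a\<in>?U. \<phi> = ?M a"
    using cls_mem[OF component_mem_piece] by blast
qed

lemma perfect_mult_iff:
  assumes artinian: "artinian_ring (quot_alg I)"
    and iso: "iso_to_field I (alg_piece d I (g + h))"
  shows "perfect_mult I (alg_piece d I g) (alg_piece d I h) (alg_piece d I (g + h)) \<longleftrightarrow>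
    (\<forall>u\<in>mpoly_piece d g. (\<forall>v\<in>mpoly_piece d h. u * v \<in> I) \<longrightarrow> u \<in> I) \<and>
    (\<forall>v\<in>mpoly_piece d h. (\<forall>u\<in>mpoly_piece d g. u * v \<in> I) \<longrightarrow> v \<in> I)"
    (is "?perfect \<longleftrightarrow> ?left \<and> ?right")
proof
  assume ?perfect
  then have inj: "inj_on (\<lambda>u. \<lambda>v\<in>alg_piece d I h. u \<otimes>\<^bsub>quot_alg I\<^esub> v) (alg_piece d I g)"
    "inj_on (\<lambda>v. \<lambda>u\<in>alg_piece d I g. u \<otimes>\<^bsub>quot_alg I\<^esub> v) (alg_piece d I h)"
    by (auto simp: perfect_mult_def bij_betw_def)
  have ?left
  proof (intro ballI impI)
    fix u assume u: "u \<in> mpoly_piece d g" "\<forall>v\<in>mpoly_piece d h. u * v \<in> I"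
    have "cls I u = cls I 0"
      by (rule inj_onD[OF inj(1)])
        (use u in \<open>auto simp: alg_piece_def cls_eq_iff intro!: restrict_ext del: equalityI\<close>)
    then show "u \<in> I"
      by (simp add: cls_eq_iff)
  qed
  moreover have ?right
  proof (intro ballI impI)
    fix v assume v: "v \<in> mpoly_piece d h" "\<forall>u\<in>mpoly_piece d g. u * v \<in> I"
    have "cls I v = cls I 0"
      by (rule inj_onD[OF inj(2)])
        (use v in \<open>auto simp: alg_piece_def cls_eq_iff intro!: restrict_ext del: equalityI\<close>)
    then show "v \<in> I"
      by (simp add: cls_eq_iff)
  qed
  ultimately show "?left \<and> ?right" ..
next
  assume nondeg: "?left \<and> ?right"
  have comm: "(\<lambda>u\<in>alg_piece d I g. u \<otimes>\<^bsub>quot_alg I\<^esub> v) = (\<lambda>u\<in>alg_piece d I g. v \<otimes>\<^bsub>quot_alg I\<^esub> u)"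
    if "v \<in> alg_piece d I h" for v
    using that by (intro restrict_ext) (auto simp: alg_piece_def mult.commute)
  have "bij_betw (\<lambda>v. \<lambda>u\<in>alg_piece d I g. v \<otimes>\<^bsub>quot_alg I\<^esub> u) (alg_piece d I h)
      (alg_Hom I (alg_piece d I g) (alg_piece d I (h + g)))"
    using nondeg iso
    by (intro bij_betw_pairing artinian) (auto simp: add.commute mult.commute)
  then have "bij_betw (\<lambda>v. \<lambda>u\<in>alg_piece d I g. u \<otimes>\<^bsub>quot_alg I\<^esub> v) (alg_piece d I h)
      (alg_Hom I (alg_piece d I g) (alg_piece d I (g + h)))"
    by (subst bij_betw_cong[where g = "\<lambda>v. \<lambda>u\<in>alg_piece d I g. v \<otimes>\<^bsub>quot_alg I\<^esub> u"])
      (simp_all add: comm add.commute)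
  moreover have "bij_betw (\<lambda>u. \<lambda>v\<in>alg_piece d I h. u \<otimes>\<^bsub>quot_alg I\<^esub> v) (alg_piece d I g)
      (alg_Hom I (alg_piece d I h) (alg_piece d I (g + h)))"
    using nondeg by (intro bij_betw_pairing artinian iso) auto
  ultimately show ?perfect
    by (simp add: perfect_mult_def)
qed

end

section \<open>The two implications\<close>

context positively_graded_quotient
begin

text \<open>Everything follows from \<open>partner\<close>: a nonzero homogeneous element of degree \<open>g\<close> has a nonzero
  product with some element of degree \<open>\<omega> - g\<close>, because it has a nonzero homogeneous multiple in
  the socle.\<close>

lemma poincare_duality_if_cox_gorenstein:
  assumes artinian: "artinian_ring (quot_alg I)" and cg: "cox_gorenstein d I"
  shows "poincare_duality d I"
proof -
  obtain \<omega> where soc: "socle I = alg_piece d I \<omega>" and iso: "iso_to_field I (alg_piece d I \<omega>)"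
    using cg by (auto simp: cox_gorenstein_def)
  have partner: "\<exists>h\<in>mpoly_piece d (\<omega> - g). f * h \<notin> I" if f: "f \<in> mpoly_piece d g" "f \<notin> I" for f g
  proof -
    obtain k h where h: "h \<in> mpoly_piece d k" "f * h \<notin> I" "\<And>i. f * h * mvar i \<in> I"
      using exists_multiple_killed_by_mvars[OF artinian f] by blast
    then have "cls I (f * h) \<in> alg_piece d I \<omega>"
      unfolding soc[symmetric] by (simp add: cls_mem_socle_iff)
    then obtain w where w: "w \<in> mpoly_piece d \<omega>" "f * h - w \<in> I"
      by (auto simp: alg_piece_def cls_eq_iff)
    have "g + k = \<omega>"
    proof (rule ccontr)
      assume "g + k \<noteq> \<omega>"
      then have "mpoly_component d (g + k) (f * h - w) = f * h"
        using component_of_piece[OF mult_mem_piece[OF f(1) h(1)]] component_of_piece[OF w(1)]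
        by (simp add: component_diff)
      then show False
        using component_mem[OF w(2)] h(2) by metis
    qed
    then have "k = \<omega> - g"
      by (simp add: algebra_simps)
    then show ?thesis
      using h by blast
  qed
  have partner_right: "\<exists>h\<in>mpoly_piece d g. h * f \<notin> I"
    if "f \<in> mpoly_piece d (\<omega> - g)" "f \<notin> I" for f g
    using partner[OF that] by (simp add: mult.commute)
  have greatest: "greatest_piece d I \<omega>"
    unfolding greatest_piece_def alg_piece_eq_zero_iff
  proof (intro conjI allI impI)
    have "(1 :: ('x, 'k) mpoly) \<in> mpoly_piece d 0"
      unfolding one_eq_mconst by (rule mconst_mem_piece)
    then show "\<not> mpoly_piece d \<omega> \<subseteq> I"
      using partner[of 1 0] one_notin by auto
  next
    fix g assume "\<not> mpoly_piece d g \<subseteq> I"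
    then obtain f h where "f \<in> mpoly_piece d g" "h \<in> mpoly_piece d (\<omega> - g)" "f * h \<notin> I"
      using partner by blast
    then have "0 \<le> \<omega> - g"
      using degree_nonneg mult_mem_left by blast
    then show "g \<le> \<omega>"
      by simp
  qed
  have perfect: "perfect_mult I (alg_piece d I g) (alg_piece d I (\<omega> - g)) (alg_piece d I \<omega>)" for g
    using perfect_mult_iff[OF artinian, of g "\<omega> - g"] iso partner partner_right
    by fastforce
  have vanish: "mpoly_piece d g \<subseteq> I \<longleftrightarrow> mpoly_piece d (\<omega> - g) \<subseteq> I" for g
    using partner partner_right by (meson mult_mem_left mult_mem_right subset_iff)
  show ?thesis
    unfolding poincare_duality_def alg_piece_eq_zero_iff using greatest iso perfect vanish by blast
qed

text \<open>Greatestness of \<open>\<omega>\<close> puts \<open>A\<^sub>\<omega>\<close> in the socle, and nondegeneracy excludes socle elements of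
  any other degree.\<close>

lemma cox_gorenstein_if_poincare_duality:
  assumes artinian: "artinian_ring (quot_alg I)" and pd: "poincare_duality d I"
  shows "cox_gorenstein d I"
proof -
  obtain \<omega> where
    greatest: "\<And>g. \<not> mpoly_piece d g \<subseteq> I \<Longrightarrow> g \<le> \<omega>" and
    iso: "iso_to_field I (alg_piece d I \<omega>)" and
    perfect: "\<And>g. \<not> mpoly_piece d g \<subseteq> I \<Longrightarrow> \<not> mpoly_piece d (\<omega> - g) \<subseteq> I \<Longrightarrow>
      perfect_mult I (alg_piece d I g) (alg_piece d I (\<omega> - g)) (alg_piece d I \<omega>)" and
    vanish: "\<And>g. mpoly_piece d g \<subseteq> I \<longleftrightarrow> mpoly_piece d (\<omega> - g) \<subseteq> I"
    using pd unfolding poincare_duality_def greatest_piece_def alg_piece_eq_zero_iff by blast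
  have partner: "\<exists>h\<in>mpoly_piece d (\<omega> - g). f * h \<notin> I" if f: "f \<in> mpoly_piece d g" "f \<notin> I" for f g
  proof -
    have "perfect_mult I (alg_piece d I g) (alg_piece d I (\<omega> - g)) (alg_piece d I \<omega>)"
      using f vanish[of g] by (intro perfect) auto
    then show ?thesis
      using perfect_mult_iff[OF artinian, of g "\<omega> - g"] iso f by auto
  qed
  have "cls I f \<in> socle I \<longleftrightarrow> cls I f \<in> alg_piece d I \<omega>" for f
  proof
    assume "cls I f \<in> socle I"
    then have kills: "f * mvar i \<in> I" for i
      by (simp add: cls_mem_socle_iff)
    have comp_kills: "mpoly_component d g f * mvar i \<in> I" for g i
      using component_mem[OF kills[of i], where g = "g + d i"]
        component_mult[OF mvar_mem_piece[of i], where h = "g + d i" and r = f]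
      by (simp add: mult.commute)
    have comp: "mpoly_component d g f \<in> I" if "g \<noteq> \<omega>" for g
    proof (rule ccontr)
      assume "mpoly_component d g f \<notin> I"
      then obtain h where h: "h \<in> mpoly_piece d (\<omega> - g)" "mpoly_component d g f * h \<notin> I"
        using partner[OF component_mem_piece] by blast
      have "Poly_Mapping.lookup h 0 = 0"
      proof (rule ccontr)
        assume "Poly_Mapping.lookup h 0 \<noteq> 0"
        then have "mdeg d 0 = \<omega> - g"
          using h(1) by (simp add: mpoly_piece_def in_keys_iff)
        then show False
          using that by (simp add: mdeg_def)
      qed
      then show False
        using mult_mem_if_no_constant_term[OF comp_kills] h(2) by blast
    qed
    have "f - mpoly_component d \<omega> f \<in> I"
      by (rule mem_if_components_mem)
        (use comp in \<open>auto simp: component_diff component_of_piece[OF component_mem_piece]\<close>)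
    then have "cls I f = cls I (mpoly_component d \<omega> f)"
      by (simp add: cls_eq_iff)
    then show "cls I f \<in> alg_piece d I \<omega>"
      by (simp add: alg_piece_def)
  next
    assume "cls I f \<in> alg_piece d I \<omega>"
    then obtain w where w: "w \<in> mpoly_piece d \<omega>" "cls I f = cls I w"
      by (auto simp: alg_piece_def)
    have "w * mvar i \<in> I" for i
    proof (rule ccontr)
      assume *: "w * mvar i \<notin> I"
      then have "\<omega> + d i \<le> \<omega>"
        using mult_mem_piece[OF w(1) mvar_mem_piece] by (intro greatest) blast
      moreover have "0 \<le> d i"
        using * by (intro degree_nonneg[OF mvar_mem_piece]) (blast intro: mult_mem_left)
      ultimately show False
        using degree_mvar_nonzero[of i] by simp
    qed
    then show "cls I f \<in> socle I"
      by (simp add: w(2) cls_mem_socle_iff)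
  qed
  then have "socle I = alg_piece d I \<omega>"
    unfolding socle_def alg_piece_def carrier_quot by auto
  then show ?thesis
    using iso by (auto simp: cox_gorenstein_def)
qed

end

theorem theorem4p6:
  fixes d :: "'x::finite \<Rightarrow> 'g::ordered_ab_group_add"
    and I :: "('x, 'k::field_char_0) mpoly set"
  assumes "graded_algebra d I"
    and "positively_graded d I"
    and "artinian_ring (quot_alg I)"
  shows "cox_gorenstein d I \<longleftrightarrow> poincare_duality d I"
proof -
  interpret positively_graded_quotient d I
    by unfold_locales (rule assms)+
  show ?thesis
    using poincare_duality_if_cox_gorenstein cox_gorenstein_if_poincare_duality assms(3) by blast
qed

end
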